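(* Let $q,b,z_d\in\mathbb{R}$ with $q\neq0$, and $M_1>0$. Let $g_{op}$ be the minimizer of $J_1$ over $\mathbb{R}$ and, for $h=x_0/n$ with $n\ge1$ an integer, let $g^h_{op}$ be the minimizer of $J_1^h$ over $\mathbb{R}$. (a) $$g^h_{op}=\frac{q}{3x_0}\,\frac{A_1+\frac h{x_0}A_2+\frac{h^2}{x_0^2}A_3}{A_4+A_5(h)},$$ where $A_1=\tfrac58-\tfrac{b-z_d}{qx_0}$, $A_2=\tfrac{3(b-z_d)}{4qx_0}-\tfrac12$, $A_3=\tfrac{b-z_d}{4qx_0}-\tfrac18$, $A_4=\tfrac2{15}+\tfrac{M_1}{x_0^4}$, $A_5(h)=\tfrac h{12x_0}\left(\tfrac{h^3}{15x_0^3}+\tfrac{h^2}{2x_0^2}+\tfrac h{3x_0}-\tfrac52\right)$. (b) There are constants $C_3,C_4$ not depending on $h$ such that, as $h\to0$ ($h=x_0/n$, $n\to\infty$), $$|g_{op}-g^h_{op}|=C_3h+o(h),\qquad |J_1(g_{op})-J_1^h(g^h_{op})|=C_4h+o(h).$$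
   Context: Fix $x_0,y_0>0$, $\Omega=(0,x_0)\times(0,y_0)$ and $H=L^2(\Omega)$ with its standard norm. For constants $g,q,b\in\mathbb{R}$, the system $-\Delta u=g$ in $\Omega$, $u=b$ on $\{0\}\times(0,y_0]$, $-\partial u/\partial n=q$ on $\{x_0\}\times(0,y_0]$, $-\partial u/\partial n=0$ on $[0,x_0]\times\{0,y_0\}$ has solution $u_g(x,y)=-\tfrac12gx^2+(gx_0-q)x+b$. For an integer $n\ge1$, $h=x_0/n$, $x_i=(i-1)h$, its discrete (finite-difference, piecewise linear) approximation is $u^h_g(x,y)=(gx_0-q-hgi)x+h^2g\tfrac{i(i-1)}2+b$ for $x\in[x_i,x_{i+1}]$, $y\in[0,y_0]$, $i=1,\dots,n$. For fixed $q,b,z_d\in\mathbb{R}$ and $M_1>0$ the cost functions on $\mathbb{R}$ are $J_1(g)=\tfrac12\|u_g-z_d\|_H^2+\tfrac{M_1}2\|g\|_H^2$ and $J^h_1(g)=\tfrac12\|u^h_g-z_d\|_H^2+\tfrac{M_1}2\|g\|_H^2$, where constants are viewed as constant functions on $\Omega$ (so $\|g\|_H^2=x_0y_0g^2$). The minimizer of $J_1$ is $g_{op}=\frac{q}{3x_0}\left(\tfrac58-\tfrac{b-z_d}{qx_0}\right)\Big/\left(\tfrac2{15}+\tfrac{M_1}{x_0^4}\right)$. *)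

theory Defs
  imports "HOL-Analysis.Analysis" "HOL-Library.Landau_Symbols"
begin

definition Omega :: "real \<Rightarrow> real \<Rightarrow> (real \<times> real) set" where
  "Omega x0 y0 = {0<..<x0} \<times> {0<..<y0}"

definition H_norm :: "real \<Rightarrow> real \<Rightarrow> (real \<times> real \<Rightarrow> real) \<Rightarrow> real" where
  "H_norm x0 y0 f = sqrt (LINT p:Omega x0 y0|lborel. (f p)\<^sup>2)"

(* The solution of the mixed boundary value problem -Laplace u = g in Omega, u = b on the left
   side, -du/dn = q on the right side, -du/dn = 0 on the horizontal sides: see state_solves. *)
definition state :: "real \<Rightarrow> real \<Rightarrow> real \<Rightarrow> real \<Rightarrow> real \<times> real \<Rightarrow> real" where
  "state x0 q b g = (\<lambda>(x, y). - (1/2) * g * x\<^sup>2 + (g * x0 - q) * x + b)"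

definition node :: "real \<Rightarrow> nat \<Rightarrow> real" where
  "node h i = (real i - 1) * h"

(* The cells are closed, so an interior node lies in two of them. The smaller index is chosen;
   lemma discrete_state_eq shows that both indices give the same value. *)
definition cell_index :: "real \<Rightarrow> nat \<Rightarrow> real \<Rightarrow> nat" where
  "cell_index x0 n x = (LEAST i. i \<in> {1..n} \<and> x \<in> {node (x0 / real n) i..node (x0 / real n) (i + 1)})"

definition discrete_state ::
  "real \<Rightarrow> real \<Rightarrow> real \<Rightarrow> nat \<Rightarrow> real \<Rightarrow> real \<times> real \<Rightarrow> real" where
  "discrete_state x0 q b n g = (\<lambda>(x, y).
     let h = x0 / real n; i = real (cell_index x0 n x)
     in (g * x0 - q - h * g * i) * x + h\<^sup>2 * g * (i * (i - 1) / 2) + b)"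

(* In M1/2 * (H_norm x0 y0 (\<lambda>_. g))^2 the number g is viewed as a constant function on Omega. *)
definition J1 :: "real \<Rightarrow> real \<Rightarrow> real \<Rightarrow> real \<Rightarrow> real \<Rightarrow> real \<Rightarrow> real \<Rightarrow> real" where
  "J1 x0 y0 q b zd M1 g =
     1/2 * (H_norm x0 y0 (\<lambda>p. state x0 q b g p - zd))\<^sup>2 + M1/2 * (H_norm x0 y0 (\<lambda>_. g))\<^sup>2"

definition J1h :: "real \<Rightarrow> real \<Rightarrow> real \<Rightarrow> real \<Rightarrow> real \<Rightarrow> real \<Rightarrow> nat \<Rightarrow> real \<Rightarrow> real" where
  "J1h x0 y0 q b zd M1 n g =
     1/2 * (H_norm x0 y0 (\<lambda>p. discrete_state x0 q b n g p - zd))\<^sup>2 + M1/2 * (H_norm x0 y0 (\<lambda>_. g))\<^sup>2"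

(* These choices are unambiguous: see J1_ex1_minimizer and J1h_ex1_minimizer. *)
definition g_op :: "real \<Rightarrow> real \<Rightarrow> real \<Rightarrow> real \<Rightarrow> real \<Rightarrow> real \<Rightarrow> real" where
  "g_op x0 y0 q b zd M1 = (ARG_MIN (J1 x0 y0 q b zd M1) g. True)"

definition gh_op :: "real \<Rightarrow> real \<Rightarrow> real \<Rightarrow> real \<Rightarrow> real \<Rightarrow> real \<Rightarrow> nat \<Rightarrow> real" where
  "gh_op x0 y0 q b zd M1 n = (ARG_MIN (J1h x0 y0 q b zd M1 n) g. True)"

lemma state_solves:
  shows "- (deriv (deriv (\<lambda>s. state x0 q b g (s, y))) x + deriv (deriv (\<lambda>t. state x0 q b g (x, t))) y) = g"
    and "state x0 q b g (0, y) = b"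
    and "- deriv (\<lambda>s. state x0 q b g (s, y)) x0 = q"
    and "- deriv (\<lambda>t. state x0 q b g (x, t)) y = 0"
proof -
  have d1: "deriv (\<lambda>s. state x0 q b g (s, y)) = (\<lambda>s. - g * s + (g * x0 - q))"
    by (rule ext, rule DERIV_imp_deriv) (auto simp: state_def intro!: derivative_eq_intros)
  have d2: "deriv (\<lambda>s. - g * s + (g * x0 - q)) x = - g"
    by (rule DERIV_imp_deriv) (auto intro!: derivative_eq_intros)
  have e: "deriv (\<lambda>t. state x0 q b g (x, t)) = (\<lambda>t. 0)"
    by (rule ext, rule DERIV_imp_deriv) (auto simp: state_def)
  show "- (deriv (deriv (\<lambda>s. state x0 q b g (s, y))) x + deriv (deriv (\<lambda>t. state x0 q b g (x, t))) y) = g"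
    unfolding d1 d2 e by simp
  show "state x0 q b g (0, y) = b" by (simp add: state_def)
  show "- deriv (\<lambda>s. state x0 q b g (s, y)) x0 = q" unfolding d1 by simp
  show "- deriv (\<lambda>t. state x0 q b g (x, t)) y = 0" unfolding e by simp
qed

lemma discrete_state_eq:
  fixes x0 x y q b g :: real and n i :: nat
  assumes "x0 > 0" "i \<in> {1..n}" "h = x0 / real n" "x \<in> {node h i..node h (i + 1)}"
  shows "discrete_state x0 q b n g (x, y)
    = (g * x0 - q - h * g * real i) * x + h\<^sup>2 * g * (real i * (real i - 1) / 2) + b"
proof -
  define P where "P = (\<lambda>j. j \<in> {1..n} \<and> x \<in> {node h j..node h (j + 1)})"
  define j where "j = cell_index x0 n x"
  have jL: "j = (LEAST j. P j)" by (simp add: j_def P_def cell_index_def assms(3))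
  have Pi: "P i" using assms by (simp add: P_def)
  have Pj: "P j" unfolding jL by (rule LeastI[of P, OF Pi])
  have ji: "j \<le> i" unfolding jL by (rule Least_le[of P, OF Pi])
  have h: "h > 0" using assms by auto
  have "(real i - 1) * h \<le> real j * h"
    using Pi Pj by (auto simp: P_def node_def)
  hence "real i - 1 \<le> real j" using h by simp
  hence "i = j \<or> i = Suc j" using ji by linarith
  thus ?thesis
  proof
    assume "i = j" thus ?thesis
      by (simp add: discrete_state_def Let_def j_def[symmetric] assms(3))
  next
    assume ij: "i = Suc j"
    hence x: "x = real j * h" using Pi Pj by (auto simp: P_def node_def)
    have "discrete_state x0 q b n g (x, y)
        = (g * x0 - q - h * g * real j) * x + h\<^sup>2 * g * (real j * (real j - 1) / 2) + b"
      by (simp add: discrete_state_def Let_def j_def[symmetric] assms(3))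
    also have "(g * x0 - q - h * g * real j) * x = (g * x0 - q - h * g * real i) * x + h\<^sup>2 * g * real j"
      by (simp add: ij x algebra_simps power2_eq_square)
    also have "h\<^sup>2 * g * (real j * (real j - 1) / 2) = h\<^sup>2 * g * (real i * (real i - 1) / 2 - real j)"
      by (simp add: ij field_simps)
    finally show ?thesis
      by (simp add: right_diff_distrib)
  qed
qed

lemma measurable_Omega: "Omega x0 y0 \<in> sets lborel"
  unfolding Omega_def by (simp add: borel_open open_Times)

lemma emeasure_Omega:
  assumes "x0 > 0" "y0 > 0"
  shows "emeasure lborel (Omega x0 y0) = ennreal (x0 * y0)"
proof -
  have "emeasure lborel (Omega x0 y0) = emeasure (lborel \<Otimes>\<^sub>M lborel) ({0<..<x0} \<times> {0<..<y0})"
    by (simp add: lborel_prod Omega_def)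
  also have "\<dots> = emeasure lborel {0<..<x0} * emeasure lborel {0<..<y0}"
    by (rule lborel.emeasure_pair_measure_Times) auto
  also have "\<dots> = ennreal (x0 * y0)" using assms by (simp add: ennreal_mult)
  finally show ?thesis .
qed

lemma H_norm_power2: "(H_norm x0 y0 f)\<^sup>2 = (LINT p:Omega x0 y0|lborel. (f p)\<^sup>2)"
  unfolding H_norm_def set_lebesgue_integral_def by (simp add: integral_nonneg_AE)

lemma H_norm_const_power2:
  assumes "x0 > 0" "y0 > 0"
  shows "(H_norm x0 y0 (\<lambda>_. c))\<^sup>2 = x0 * y0 * c\<^sup>2"
  using assms measurable_Omega[of x0 y0] emeasure_Omega[OF assms]
  by (simp add: H_norm_power2 set_lebesgue_integral_def measure_def)

lemma set_integrable_Omega: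
  fixes f :: "real \<times> real \<Rightarrow> real"
  assumes "x0 > 0" "y0 > 0" "f \<in> borel_measurable borel" "\<And>p. p \<in> Omega x0 y0 \<Longrightarrow> \<bar>f p\<bar> \<le> B"
  shows "set_integrable lborel (Omega x0 y0) f"
  unfolding set_integrable_def
  by (rule integrableI_bounded_set[where A = "Omega x0 y0" and B = B])
     (use assms measurable_Omega emeasure_Omega[OF assms(1,2)] in \<open>auto simp: indicator_def\<close>)

lemma ex1_minimizer:
  fixes J :: "real \<Rightarrow> real" and u :: "real \<Rightarrow> real \<times> real \<Rightarrow> real"
  assumes "x0 > 0" "y0 > 0" "M1 > 0"
    and J: "\<And>g. J g = 1/2 * (H_norm x0 y0 (\<lambda>p. u g p - zd))\<^sup>2 + M1/2 * (H_norm x0 y0 (\<lambda>_. g))\<^sup>2"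
    and u: "\<And>g p. p \<in> Omega x0 y0 \<Longrightarrow> u g p = g * f p + w p"
    and m: "f \<in> borel_measurable borel" "w \<in> borel_measurable borel"
    and B: "\<And>p. p \<in> Omega x0 y0 \<Longrightarrow> \<bar>f p\<bar> \<le> B" "\<And>p. p \<in> Omega x0 y0 \<Longrightarrow> \<bar>w p\<bar> \<le> B"
  shows "\<exists>!g. is_arg_min J (\<lambda>_. True) g"
proof -
  let ?S = "Omega x0 y0"
  define v where "v = (\<lambda>p. w p - zd)"
  define C where "C = B + \<bar>zd\<bar>"
  have Bf: "\<bar>f p\<bar> \<le> C" "\<bar>v p\<bar> \<le> C" if "p \<in> ?S" for p
    using B[OF that] by (auto simp: C_def v_def)
  have mv: "v \<in> borel_measurable borel" unfolding v_def using m by measurable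
  have bd: "\<bar>s * t\<bar> \<le> C * C" if "\<bar>s\<bar> \<le> C" "\<bar>t\<bar> \<le> C" for s t :: real
    using that unfolding abs_mult by (intro mult_mono) auto
  have i1: "set_integrable lborel ?S (\<lambda>p. f p * f p)"
    by (rule set_integrable_Omega[OF assms(1,2) borel_measurable_times[OF m(1) m(1)] bd[OF Bf(1) Bf(1)]])
  have i2: "set_integrable lborel ?S (\<lambda>p. f p * v p)"
    by (rule set_integrable_Omega[OF assms(1,2) borel_measurable_times[OF m(1) mv] bd[OF Bf(1) Bf(2)]])
  have i3: "set_integrable lborel ?S (\<lambda>p. v p * v p)"
    by (rule set_integrable_Omega[OF assms(1,2) borel_measurable_times[OF mv mv] bd[OF Bf(2) Bf(2)]])
  define F where "F = (LINT p:?S|lborel. f p * f p)"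
  define G where "G = (LINT p:?S|lborel. f p * v p)"
  define K where "K = (LINT p:?S|lborel. v p * v p)"
  define a where "a = (F + M1 * x0 * y0) / 2"
  have "F \<ge> 0" unfolding F_def set_lebesgue_integral_def by (simp add: integral_nonneg_AE)
  hence a: "a > 0" using assms by (auto simp: a_def intro: add_nonneg_pos)
  have JJ: "J g = a * g\<^sup>2 + G * g + K / 2" for g
  proof -
    have "(H_norm x0 y0 (\<lambda>p. u g p - zd))\<^sup>2
        = (LINT p:?S|lborel. (g * g) * (f p * f p) + (2 * g) * (f p * v p) + v p * v p)"
      unfolding H_norm_power2
      by (rule set_lebesgue_integral_cong[OF measurable_Omega])
         (auto simp: u v_def algebra_simps power2_eq_square)
    also have "\<dots> = (g * g) * F + (2 * g) * G + K"
      unfolding F_def G_def K_def using i1 i2 i3 by (simp add: set_integral_add)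
    finally show ?thesis
      unfolding J H_norm_const_power2[OF assms(1,2)] by (simp add: a_def field_simps power2_eq_square)
  qed
  define g0 where "g0 = - G / (2 * a)"
  have sq: "J g = J g0 + a * (g - g0)\<^sup>2" for g
    using a unfolding JJ g0_def by (simp add: field_simps power2_eq_square)
  have "is_arg_min J (\<lambda>_. True) g0"
  proof -
    have "J g0 \<le> J g" for g
      using a sq[of g] by simp
    thus ?thesis by (simp add: is_arg_min_def not_less)
  qed
  moreover have "g = g0" if "is_arg_min J (\<lambda>_. True) g" for g
  proof -
    have "\<not> J g0 < J g" using that by (auto simp: is_arg_min_def)
    hence "a * (g - g0)\<^sup>2 \<le> 0" using sq[of g] by simp
    thus ?thesis using a by (simp add: mult_le_0_iff)
  qed
  ultimately show ?thesis by blast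
qed

lemma J1_ex1_minimizer:
  assumes "x0 > 0" "y0 > 0" "M1 > 0"
  shows "\<exists>!g. is_arg_min (J1 x0 y0 q b zd M1) (\<lambda>_. True) g"
proof (rule ex1_minimizer[OF assms J1_def,
      where f = "\<lambda>p. x0 * fst p - (fst p)\<^sup>2 / 2" and w = "\<lambda>p. b - q * fst p"
        and B = "x0 * x0 + \<bar>b\<bar> + \<bar>q\<bar> * x0"])
  fix p assume p: "p \<in> Omega x0 y0"
  hence x: "0 < fst p" "fst p < x0" by (auto simp: Omega_def)
  have "fst p * fst p \<le> x0 * fst p" "x0 * fst p \<le> x0 * x0" "0 \<le> fst p * fst p"
    using x by (auto intro: mult_right_mono mult_left_mono)
  moreover have "\<bar>q * fst p\<bar> \<le> \<bar>q\<bar> * x0" using x by (auto simp: abs_mult intro: mult_left_mono)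
  ultimately show "\<bar>x0 * fst p - (fst p)\<^sup>2 / 2\<bar> \<le> x0 * x0 + \<bar>b\<bar> + \<bar>q\<bar> * x0"
    and "\<bar>b - q * fst p\<bar> \<le> x0 * x0 + \<bar>b\<bar> + \<bar>q\<bar> * x0"
    unfolding power2_eq_square by linarith+
next
  show "(\<lambda>p. x0 * fst p - (fst p)\<^sup>2 / 2) \<in> borel_measurable borel"
    by (intro borel_measurable_continuous_onI continuous_intros) auto
  show "(\<lambda>p. b - q * fst p) \<in> borel_measurable borel"
    by (intro borel_measurable_continuous_onI continuous_intros)
qed (auto simp: state_def algebra_simps split: prod.split)

lemma J1h_ex1_minimizer:
  assumes "x0 > 0" "y0 > 0" "M1 > 0" "n \<ge> 1"
  shows "\<exists>!g. is_arg_min (J1h x0 y0 q b zd M1 n) (\<lambda>_. True) g"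
proof -
  define h where "h = x0 / real n"
  have h: "h > 0" "h \<le> x0" "real n * h = x0" using assms by (auto simp: h_def field_simps)
  define c where "c = (\<lambda>p::real \<times> real. real_of_int \<lceil>fst p / h\<rceil>)"
  have c: "1 \<le> c p" "c p \<le> real n" if "p \<in> Omega x0 y0" for p
  proof -
    have x: "0 < fst p" "fst p < x0" using that by (auto simp: Omega_def)
    have "0 < fst p / h" using x h by simp
    hence "0 < \<lceil>fst p / h\<rceil>" by simp
    thus "1 \<le> c p" unfolding c_def by linarith
    have "fst p / h \<le> real n" using x h by (simp add: field_simps)
    hence "\<lceil>fst p / h\<rceil> \<le> int n" by (simp add: ceiling_le_iff)
    thus "c p \<le> real n" unfolding c_def by linarith
  qed
  show ?thesis
  proof (rule ex1_minimizer[OF assms(1-3) J1h_def,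
      where f = "\<lambda>p. (x0 - h * c p) * fst p + h\<^sup>2 * (c p * (c p - 1) / 2)" and w = "\<lambda>p. b - q * fst p"
        and B = "(x0 * x0 + x0 * x0) + \<bar>b\<bar> + \<bar>q\<bar> * x0"])
    fix p assume p: "p \<in> Omega x0 y0"
    hence x: "0 < fst p" "fst p < x0" by (auto simp: Omega_def)
    have hc: "0 \<le> h * c p" "h * c p \<le> x0"
    proof -
      show "0 \<le> h * c p" by (rule mult_nonneg_nonneg) (use c[OF p] h in linarith)+
      have "h * c p \<le> h * real n" by (rule mult_left_mono) (use c[OF p] h in linarith)+
      thus "h * c p \<le> x0" using h(3) by (simp only: mult.commute)
    qed
    have hc1: "0 \<le> h * (c p - 1)" "h * (c p - 1) \<le> x0"
    proof -
      show "0 \<le> h * (c p - 1)" by (rule mult_nonneg_nonneg) (use c[OF p] h in linarith)+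
      show "h * (c p - 1) \<le> x0" using hc(2) h(1) unfolding right_diff_distrib by linarith
    qed
    have mm: "0 \<le> s * t \<and> s * t \<le> x0 * x0"
      if "0 \<le> s" "s \<le> x0" "0 \<le> t" "t \<le> x0" for s t :: real
      using mult_mono[OF that(2) that(4)] mult_nonneg_nonneg[OF that(1) that(3)] that by linarith
    have "0 \<le> (x0 - h * c p) * fst p" "(x0 - h * c p) * fst p \<le> x0 * x0"
      using mm[of "x0 - h * c p" "fst p"] x hc by linarith+
    moreover have "0 \<le> (h * c p) * (h * (c p - 1))" "(h * c p) * (h * (c p - 1)) \<le> x0 * x0"
      using mm[OF hc hc1] by linarith+
    moreover have "h\<^sup>2 * (c p * (c p - 1) / 2) = (h * c p) * (h * (c p - 1)) / 2"
      by (simp add: power2_eq_square)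
    moreover have "\<bar>q * fst p\<bar> \<le> \<bar>q\<bar> * x0" using x by (auto simp: abs_mult intro: mult_left_mono)
    moreover have "0 \<le> x0 * x0" by simp
    ultimately show "\<bar>(x0 - h * c p) * fst p + h\<^sup>2 * (c p * (c p - 1) / 2)\<bar> \<le> (x0 * x0 + x0 * x0) + \<bar>b\<bar> + \<bar>q\<bar> * x0"
      and "\<bar>b - q * fst p\<bar> \<le> (x0 * x0 + x0 * x0) + \<bar>b\<bar> + \<bar>q\<bar> * x0"
      by linarith+
    fix g
    define i where "i = nat \<lceil>fst p / h\<rceil>"
    have ic: "real i = c p" using c(1)[OF p] by (simp add: i_def c_def)
    have "c p - 1 < fst p / h" "fst p / h \<le> c p" unfolding c_def by linarith+
    hence "(c p - 1) * h \<le> fst p" "fst p \<le> c p * h"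
      using h(1) by (simp_all add: pos_less_divide_eq pos_divide_le_eq)
    hence "fst p \<in> {node h i..node h (i + 1)}"
      by (simp add: node_def ic)
    moreover have "i \<in> {1..n}" using c[OF p] unfolding ic[symmetric] by auto
    ultimately have "discrete_state x0 q b n g (fst p, snd p)
        = (g * x0 - q - h * g * c p) * fst p + h\<^sup>2 * g * (c p * (c p - 1) / 2) + b"
      unfolding ic[symmetric] by (intro discrete_state_eq[OF assms(1) _ h_def])
    also have "\<dots> = g * ((x0 - h * c p) * fst p + h\<^sup>2 * (c p * (c p - 1) / 2)) + (b - q * fst p)"
      by (simp add: algebra_simps)
    finally show "discrete_state x0 q b n g p
        = g * ((x0 - h * c p) * fst p + h\<^sup>2 * (c p * (c p - 1) / 2)) + (b - q * fst p)"
      by simp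
  next
    have [measurable]: "fst \<in> borel_measurable (borel :: (real \<times> real) measure)"
      by (intro borel_measurable_continuous_onI continuous_intros)
    have [measurable]: "c \<in> borel_measurable borel" unfolding c_def by measurable
    show "(\<lambda>p. (x0 - h * c p) * fst p + h\<^sup>2 * (c p * (c p - 1) / 2)) \<in> borel_measurable borel"
      by measurable
    show "(\<lambda>p. b - q * fst p) \<in> borel_measurable (borel :: (real \<times> real) measure)"
      by measurable
  qed
qed

end

theory Submission
  imports Defs
begin

text \<open>
  Both the exact and the discrete state depend on the control \<open>g\<close> in the same affine way: at
  \<open>(x, y)\<close> they equal \<open>g * f x + (b - q * x)\<close>, where the unit response \<open>f\<close> is the state for
  \<open>q = b = 0\<close> and \<open>g = 1\<close>. The cost is therefore a strictly convex quadratic polynomial in \<open>g\<close>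
  (\<open>cost_eq_quadratic\<close>) that sees \<open>f\<close> only through the integrals of \<open>f\<close>, \<open>x * f x\<close> and
  \<open>(f x)\<^sup>2\<close> over \<open>{0..x0}\<close>; its minimizer and its minimum are explicit in these three moments
  (\<open>arg_min_quadratic\<close>).

  The moments of the discrete unit response are sums over the cells of integrals of affine functions
  and their squares. They add up to powers of \<open>x0\<close> times fixed polynomials in \<open>t = h / x0 = 1 / n\<close>
  (\<open>discrete_state_moments\<close>), and at \<open>t = 0\<close> the same polynomials give the moments of the exact
  unit response (\<open>state_moments\<close>). So the exact and the discrete problem belong to a single family
  with real parameter \<open>t\<close>: its optimal control and its optimal value are rational functions
  \<open>opt_control\<close> and \<open>opt_value\<close> of \<open>t\<close>, taken at \<open>0\<close> for the exact problem and at \<open>1 / n\<close>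
  for the discrete one.

  The closed form is \<open>opt_control\<close> at \<open>t = 1 / n\<close> with common powers of \<open>x0\<close> cancelled. The error
  estimates hold because the denominators do not vanish at \<open>0\<close>, so that both functions are
  differentiable there (\<open>optimum_differentiable\<close>), and
  \<open>\<bar>D 0 - D t\<bar> = \<bar>D' 0\<bar> * t + o(t)\<close> as \<open>t\<close> decreases to \<open>0\<close>, for every
  function \<open>D\<close> differentiable at \<open>0\<close>
  (\<open>differentiable_imp_abs_diff_expansion\<close>). The constants \<open>C3\<close> and \<open>C4\<close> are the absolute values
  of the two derivatives, divided by \<open>x0\<close>.
\<close>

section \<open>Costs that are quadratic in the control\<close>

text \<open>
  Fubini, together with the passage from the Lebesgue to the gauge integral, which makes the
  fundamental theorem of calculus and the splitting of intervals available for the moments.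
\<close>
lemma LINT_Omega_fst:
  fixes \<phi> :: "real \<Rightarrow> real"
  assumes pos: "x0 > 0" "y0 > 0" and cont: "continuous_on {0..x0} \<phi>"
  shows "(LINT p:Omega x0 y0|lborel. \<phi> (fst p)) = y0 * integral {0..x0} \<phi>"
proof -
  have c2: "continuous_on ({0..x0} \<times> {0..y0}) (\<lambda>p. \<phi> (fst p))"
    by (rule continuous_on_compose2[OF cont continuous_on_fst[OF continuous_on_id]]) auto
  have "set_integrable lborel ({0..x0} \<times> {0..y0}) (\<lambda>p. \<phi> (fst p))"
    unfolding set_integrable_def by (intro borel_integrable_compact compact_Times compact_Icc c2)
  hence i2: "set_integrable lborel (Omega x0 y0) (\<lambda>p. \<phi> (fst p))"
    by (rule set_integrable_subset[OF _ measurable_Omega]) (auto simp: Omega_def)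
  have "set_integrable lborel {0..x0} \<phi>"
    unfolding set_integrable_def by (intro borel_integrable_compact compact_Icc cont)
  hence i1: "set_integrable lborel {0<..<x0} \<phi>"
    by (rule set_integrable_subset) auto
  have "(LINT p:Omega x0 y0|lborel. \<phi> (fst p))
      = (LINT p|(lborel \<Otimes>\<^sub>M lborel). indicator (Omega x0 y0) p *\<^sub>R \<phi> (fst p))"
    by (simp add: set_lebesgue_integral_def lborel_prod)
  also have "\<dots> = (LINT x|lborel. LINT y|lborel. indicator (Omega x0 y0) (x, y) *\<^sub>R \<phi> (fst (x, y)))"
    by (rule lborel_pair.integral_fst'[symmetric])
       (use i2 in \<open>simp add: set_integrable_def lborel_prod\<close>)
  also have "\<dots> = (LINT x|lborel. y0 * (indicator {0<..<x0} x *\<^sub>R \<phi> x))"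
  proof (rule Bochner_Integration.integral_cong[OF refl])
    fix x :: real
    have "(LINT y|lborel. indicator (Omega x0 y0) (x, y) *\<^sub>R \<phi> (fst (x, y)))
        = (LINT y|lborel. (indicator {0<..<x0} x * \<phi> x) * indicator {0<..<y0} y)"
      by (rule Bochner_Integration.integral_cong) (auto simp: Omega_def indicator_def)
    thus "(LINT y|lborel. indicator (Omega x0 y0) (x, y) *\<^sub>R \<phi> (fst (x, y)))
        = y0 * (indicator {0<..<x0} x *\<^sub>R \<phi> x)"
      using pos by (simp add: mult.commute)
  qed
  also have "\<dots> = y0 * integral {0<..<x0} \<phi>"
    using set_borel_integral_eq_integral(2)[OF i1] by (simp add: set_lebesgue_integral_def)
  finally show ?thesis by (simp add: integral_open_interval_real)
qed

text \<open>
  Expanding \<open>(g * f x + (b - zd - q * x))\<^sup>2\<close> and integrating term by term; the remainder that is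
  independent of \<open>g\<close> is left as an integral because it is common to the exact and the discrete cost.
\<close>
lemma cost_eq_quadratic:
  fixes f :: "real \<Rightarrow> real" and u :: "real \<times> real \<Rightarrow> real"
  assumes pos: "x0 > 0" "y0 > 0" and cont: "continuous_on {0..x0} f"
    and u: "\<And>p. p \<in> Omega x0 y0 \<Longrightarrow> u p = g * f (fst p) + (b - q * fst p)"
    and m0: "(f has_integral m0) {0..x0}"
    and m1: "((\<lambda>x. x * f x) has_integral m1) {0..x0}"
    and m2: "((\<lambda>x. (f x)\<^sup>2) has_integral m2) {0..x0}"
  shows "1/2 * (H_norm x0 y0 (\<lambda>p. u p - zd))\<^sup>2 + M1/2 * (H_norm x0 y0 (\<lambda>_. g))\<^sup>2
    = y0 * ((m2 + M1 * x0) / 2 * g\<^sup>2 + ((b - zd) * m0 - q * m1) * g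
        + integral {0..x0} (\<lambda>x. (b - zd - q * x)\<^sup>2) / 2)"
proof -
  define K where "K = integral {0..x0} (\<lambda>x. (b - zd - q * x)\<^sup>2)"
  have K: "((\<lambda>x. (b - zd - q * x)\<^sup>2) has_integral K) {0..x0}"
    unfolding K_def
    by (intro integrable_integral integrable_continuous_interval continuous_intros)
  have "((\<lambda>x. g\<^sup>2 * (f x)\<^sup>2 + (2 * g * (b - zd)) * f x - (2 * g * q) * (x * f x) + (b - zd - q * x)\<^sup>2)
      has_integral g\<^sup>2 * m2 + (2 * g * (b - zd)) * m0 - (2 * g * q) * m1 + K) {0..x0}"
    by (intro has_integral_add has_integral_diff has_integral_mult_right m0 m1 m2 K)
  also have "(\<lambda>x. g\<^sup>2 * (f x)\<^sup>2 + (2 * g * (b - zd)) * f x - (2 * g * q) * (x * f x) + (b - zd - q * x)\<^sup>2)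
      = (\<lambda>x. (g * f x + (b - q * x) - zd)\<^sup>2)"
    by (rule ext) (simp add: power2_eq_square algebra_simps)
  finally have I: "integral {0..x0} (\<lambda>x. (g * f x + (b - q * x) - zd)\<^sup>2)
      = g\<^sup>2 * m2 + (2 * g * (b - zd)) * m0 - (2 * g * q) * m1 + K"
    by (rule integral_unique)
  have "(H_norm x0 y0 (\<lambda>p. u p - zd))\<^sup>2
      = (LINT p:Omega x0 y0|lborel. (g * f (fst p) + (b - q * fst p) - zd)\<^sup>2)"
    unfolding H_norm_power2 by (rule set_lebesgue_integral_cong[OF measurable_Omega]) (simp add: u)
  also have "\<dots> = y0 * integral {0..x0} (\<lambda>x. (g * f x + (b - q * x) - zd)\<^sup>2)"
    by (rule LINT_Omega_fst[OF pos, where \<phi> = "\<lambda>x. (g * f x + (b - q * x) - zd)\<^sup>2"])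
       (intro continuous_intros cont)
  finally show ?thesis
    unfolding I H_norm_const_power2[OF pos] K_def[symmetric] by (simp add: field_simps)
qed

lemma arg_min_quadratic:
  fixes J :: "real \<Rightarrow> real"
  assumes c: "c > 0" and \<alpha>: "\<alpha> > 0" and J: "\<And>g. J g = c * (\<alpha> / 2 * g\<^sup>2 + \<beta> * g + \<gamma>)"
  shows "(ARG_MIN J g. True) = - \<beta> / \<alpha>" and "J (- \<beta> / \<alpha>) = c * (\<gamma> - \<beta>\<^sup>2 / (2 * \<alpha>))"
proof -
  have sq: "J g = c * (\<gamma> - \<beta>\<^sup>2 / (2 * \<alpha>)) + c * \<alpha> / 2 * (g - - \<beta> / \<alpha>)\<^sup>2" for g
    using \<alpha> unfolding J by (simp add: field_simps power2_eq_square)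
  show eq: "J (- \<beta> / \<alpha>) = c * (\<gamma> - \<beta>\<^sup>2 / (2 * \<alpha>))" using sq[of "- \<beta> / \<alpha>"] by simp
  have "J (ARG_MIN J g. True) = J (- \<beta> / \<alpha>)"
  proof (rule arg_min_equality)
    show "J (- \<beta> / \<alpha>) \<le> J g" for g unfolding eq using sq[of g] c \<alpha> by simp
  qed simp
  thus "(ARG_MIN J g. True) = - \<beta> / \<alpha>"
    using sq[of "ARG_MIN J g. True"] eq c \<alpha> by simp
qed

section \<open>Moments of the unit response\<close>

lemma has_integral_affine_moments:
  fixes p k a b :: real
  assumes "a \<le> b"
  shows "((\<lambda>x. p * x + k) has_integral p * (b\<^sup>2 - a\<^sup>2) / 2 + k * (b - a)) {a..b}"
    and "((\<lambda>x. x * (p * x + k)) has_integral p * (b^3 - a^3) / 3 + k * (b\<^sup>2 - a\<^sup>2) / 2) {a..b}"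
    and "((\<lambda>x. (p * x + k)\<^sup>2) has_integral
      p\<^sup>2 * (b^3 - a^3) / 3 + p * k * (b\<^sup>2 - a\<^sup>2) + k\<^sup>2 * (b - a)) {a..b}"
proof -
  have "((\<lambda>x. p * x + k) has_integral (p * b\<^sup>2 / 2 + k * b) - (p * a\<^sup>2 / 2 + k * a)) {a..b}"
    by (rule fundamental_theorem_of_calculus[OF assms])
       (auto intro!: derivative_eq_intros simp: has_real_derivative_iff_has_vector_derivative[symmetric])
  thus "((\<lambda>x. p * x + k) has_integral p * (b\<^sup>2 - a\<^sup>2) / 2 + k * (b - a)) {a..b}"
    by (simp add: algebra_simps diff_divide_distrib)
  have "((\<lambda>x. x * (p * x + k)) has_integral (p * b^3 / 3 + k * b\<^sup>2 / 2) - (p * a^3 / 3 + k * a\<^sup>2 / 2)) {a..b}"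
    by (rule fundamental_theorem_of_calculus[OF assms])
       (auto intro!: derivative_eq_intros
         simp: has_real_derivative_iff_has_vector_derivative[symmetric] power2_eq_square algebra_simps)
  thus "((\<lambda>x. x * (p * x + k)) has_integral p * (b^3 - a^3) / 3 + k * (b\<^sup>2 - a\<^sup>2) / 2) {a..b}"
    by (simp add: algebra_simps diff_divide_distrib)
  have "((\<lambda>x. (p * x + k)\<^sup>2) has_integral
      (p\<^sup>2 * b^3 / 3 + p * k * b\<^sup>2 + k\<^sup>2 * b) - (p\<^sup>2 * a^3 / 3 + p * k * a\<^sup>2 + k\<^sup>2 * a)) {a..b}"
    by (rule fundamental_theorem_of_calculus[OF assms])
       (auto intro!: derivative_eq_intros
         simp: has_real_derivative_iff_has_vector_derivative[symmetric] power2_eq_square algebra_simps)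
  thus "((\<lambda>x. (p * x + k)\<^sup>2) has_integral
      p\<^sup>2 * (b^3 - a^3) / 3 + p * k * (b\<^sup>2 - a\<^sup>2) + k\<^sup>2 * (b - a)) {a..b}"
    by (simp add: algebra_simps diff_divide_distrib)
qed

text \<open>
  If \<open>P m\<close> is the conjectured value of the integral up to the \<open>m\<close>-th node, it is enough to compare
  increments on each cell. This turns the summation over cells into polynomial identities.
\<close>
lemma has_integral_telescope:
  fixes \<phi> P :: "_ \<Rightarrow> real"
  assumes "h \<ge> 0"
    and "\<And>i. i < n \<Longrightarrow> (\<phi> has_integral P (real i + 1) - P (real i)) {real i * h..(real i + 1) * h}"
  shows "(\<phi> has_integral P (real n) - P 0) {0..real n * h}"
  using assms(2)
proof (induction n)
  case (Suc n)
  have "(\<phi> has_integral (P (real n) - P 0) + (P (real n + 1) - P (real n))) {0..(real n + 1) * h}"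
    by (rule has_integral_combine[where c = "real n * h"])
       (use Suc assms(1) in \<open>auto intro!: mult_right_mono\<close>)
  thus ?case by (simp add: add.commute)
qed (simp add: has_integral_refl)

lemma continuous_on_cells:
  fixes f :: "real \<Rightarrow> real"
  assumes "h \<ge> 0"
    and "\<And>i. i < n \<Longrightarrow> continuous_on {real i * h..(real i + 1) * h} f"
  shows "continuous_on {0..real n * h} f"
  using assms(2)
proof (induction n)
  case (Suc n)
  have "{0..real (Suc n) * h} = {0..real n * h} \<union> {real n * h..(real n + 1) * h}"
    using assms(1) by (subst ivl_disj_un_two_touch) (auto simp: add.commute intro!: mult_right_mono)
  thus ?case using Suc by (auto intro!: continuous_on_closed_Un)
qed simp

text \<open>
  The moments of the unit response for step size \<open>h = t * x0\<close> (the exact one for \<open>t = 0\<close>) are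
  \<open>x0^3 * moment0 t\<close>,
  \<open>x0^4 * moment1 t\<close> and \<open>x0^5 * moment2 t\<close> (for \<open>f\<close>, \<open>x * f x\<close> and \<open>(f x)\<^sup>2\<close>); the powers of
  \<open>x0\<close> are those given by rescaling the interval to unit length.
\<close>
definition moment0 :: "real \<Rightarrow> real" where
  "moment0 t = 1/3 - t/4 - t\<^sup>2/12"

definition moment1 :: "real \<Rightarrow> real" where
  "moment1 t = 5/24 - t/6 - t\<^sup>2/24"

definition moment2 :: "real \<Rightarrow> real" where
  "moment2 t = 2/15 + t/12 * (t^3/15 + t\<^sup>2/2 + t/3 - 5/2)"

lemma state_moments:
  assumes "x0 > 0"
  defines "f \<equiv> \<lambda>x. state x0 0 0 1 (x, 0)"
  shows "(f has_integral x0^3 * moment0 0) {0..x0}"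
    and "((\<lambda>x. x * f x) has_integral x0^4 * moment1 0) {0..x0}"
    and "((\<lambda>x. (f x)\<^sup>2) has_integral x0^5 * moment2 0) {0..x0}"
proof -
  have f: "f = (\<lambda>x. x0 * x - x\<^sup>2 / 2)" by (simp add: f_def state_def fun_eq_iff)
  have FTC: "(\<psi> has_integral \<Psi> x0 - \<Psi> 0) {0..x0}"
    if "\<And>x. (\<Psi> has_real_derivative \<psi> x) (at x)" for \<psi> \<Psi> :: "real \<Rightarrow> real"
    using that assms(1)
    by (intro fundamental_theorem_of_calculus)
       (auto simp: has_real_derivative_iff_has_vector_derivative[symmetric]
         intro: has_field_derivative_at_within)
  have "(f has_integral (x0 * x0\<^sup>2 / 2 - x0^3 / 6) - (x0 * 0\<^sup>2 / 2 - 0^3 / 6)) {0..x0}"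
    unfolding f by (rule FTC) (auto intro!: derivative_eq_intros)
  thus "(f has_integral x0^3 * moment0 0) {0..x0}"
    by (simp add: moment0_def eval_nat_numeral)
  have "((\<lambda>x. x * f x) has_integral (x0 * x0^3 / 3 - x0^4 / 8) - (x0 * 0^3 / 3 - 0^4 / 8)) {0..x0}"
    unfolding f by (rule FTC) (auto intro!: derivative_eq_intros simp: field_simps eval_nat_numeral)
  thus "((\<lambda>x. x * f x) has_integral x0^4 * moment1 0) {0..x0}"
    by (simp add: moment1_def eval_nat_numeral mult.commute)
  have "((\<lambda>x. (f x)\<^sup>2) has_integral (x0\<^sup>2 * x0^3 / 3 - x0 * x0^4 / 4 + x0^5 / 20)
      - (x0\<^sup>2 * 0^3 / 3 - x0 * 0^4 / 4 + 0^5 / 20)) {0..x0}"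
    unfolding f by (rule FTC) (auto intro!: derivative_eq_intros simp: field_simps eval_nat_numeral)
  thus "((\<lambda>x. (f x)\<^sup>2) has_integral x0^5 * moment2 0) {0..x0}"
    by (simp add: moment2_def eval_nat_numeral mult.commute)
qed

text \<open>
  With cells numbered from \<open>0\<close>, so that the index below is one less than the index in the definition
  of the discrete state. The formula holds on the closed cell, hence adjacent pieces agree at the
  common node; the integrals and the continuity of the response rest on this.
\<close>
lemma discrete_state_on_cell:
  assumes "x0 > 0" "i < n" "h = x0 / real n" "x \<in> {real i * h..(real i + 1) * h}"
  shows "discrete_state x0 0 0 n 1 (x, y) = (x0 - h * (real i + 1)) * x + h\<^sup>2 * (real i * (real i + 1) / 2)"
  using discrete_state_eq[of x0 "Suc i" n h x 0 0 1 y] assms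
  by (simp add: node_def algebra_simps)

lemma discrete_state_continuous:
  assumes "x0 > 0" "n \<ge> 1"
  shows "continuous_on {0..x0} (\<lambda>x. discrete_state x0 0 0 n 1 (x, 0))"
proof -
  define h where "h = x0 / real n"
  have h: "h > 0" "real n * h = x0" using assms by (auto simp: h_def)
  have "continuous_on {0..real n * h} (\<lambda>x. discrete_state x0 0 0 n 1 (x, 0))"
  proof (rule continuous_on_cells)
    fix i assume i: "i < n"
    show "continuous_on {real i * h..(real i + 1) * h} (\<lambda>x. discrete_state x0 0 0 n 1 (x, 0))"
      by (subst continuous_on_cong[OF refl discrete_state_on_cell[OF assms(1) i h_def]])
         (auto intro!: continuous_intros)
  qed (use h in simp)
  thus ?thesis by (simp add: h)
qed

text \<open>
  On the cell with index \<open>i\<close> the discrete response is \<open>x0 * x - e x\<close>, where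
  \<open>e x = h * (i + 1) * x - h\<^sup>2 * (i * (i + 1) / 2)\<close> involves \<open>h\<close> and \<open>i\<close> but not \<open>x0\<close>.
  Each moment thus reduces to sums over the cells of the integrals of \<open>e\<close>, \<open>x * e x\<close> and \<open>(e x)\<^sup>2\<close>, which are
  polynomials in the number of cells.
\<close>
lemma discrete_state_moments:
  assumes "x0 > 0" "n \<ge> 1"
  defines "f \<equiv> \<lambda>x. discrete_state x0 0 0 n 1 (x, 0)"
  shows "(f has_integral x0^3 * moment0 (1 / real n)) {0..x0}"
    and "((\<lambda>x. x * f x) has_integral x0^4 * moment1 (1 / real n)) {0..x0}"
    and "((\<lambda>x. (f x)\<^sup>2) has_integral x0^5 * moment2 (1 / real n)) {0..x0}"
proof -
  define h where "h = x0 / real n"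
  have h: "h > 0" "real n * h = x0" and x0: "x0 = real n * h"
    using assms by (auto simp: h_def)
  have n: "real n \<noteq> 0" using assms by simp
  \<comment> \<open>The integrals over the first \<open>m\<close> cells. The brackets are the sums of the integrals of \<open>e\<close>,
    \<open>x * e x\<close> and \<open>(e x)\<^sup>2\<close> over \<open>m\<close> cells of length one.\<close>
  define P0 where "P0 = (\<lambda>m. x0 * h\<^sup>2 * m\<^sup>2/2 - h^3 * (m/12 + m\<^sup>2/4 + m^3/6))"
  define P1 where "P1 = (\<lambda>m. x0 * h^3 * m^3/3 - h^4 * (m\<^sup>2/24 + m^3/6 + m^4/8))"
  define P2 where "P2 = (\<lambda>m. x0\<^sup>2 * h^3 * m^3/3 - 2 * x0 * h^4 * (m\<^sup>2/24 + m^3/6 + m^4/8)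
      + h^5 * (m/180 + m\<^sup>2/24 + m^3/9 + m^4/8 + m^5/20))"
  have cell: "f x = (x0 - h * (real i + 1)) * x + h\<^sup>2 * (real i * (real i + 1) / 2)"
    if "i < n" "x \<in> {real i * h..(real i + 1) * h}" for i x
    unfolding f_def by (rule discrete_state_on_cell[OF assms(1) that(1) h_def that(2)])
  have le: "real i * h \<le> (real i + 1) * h" for i using h by simp
  have "(f has_integral P0 (real n) - P0 0) {0..real n * h}"
  proof (rule has_integral_telescope)
    fix i assume i: "i < n"
    show "(f has_integral P0 (real i + 1) - P0 (real i)) {real i * h..(real i + 1) * h}"
      by (subst has_integral_cong[OF cell[OF i]], assumption,
          rule has_integral_eq_rhs[OF has_integral_affine_moments(1)[OF le]])
         (simp add: P0_def field_simps eval_nat_numeral)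
  qed (use h in simp)
  moreover have "P0 (real n) - P0 0 = x0^3 * moment0 (1 / real n)"
    using n by (simp add: P0_def moment0_def x0 field_simps eval_nat_numeral)
  ultimately show "(f has_integral x0^3 * moment0 (1 / real n)) {0..x0}" by (simp add: h)
  have "((\<lambda>x. x * f x) has_integral P1 (real n) - P1 0) {0..real n * h}"
  proof (rule has_integral_telescope)
    fix i assume i: "i < n"
    show "((\<lambda>x. x * f x) has_integral P1 (real i + 1) - P1 (real i)) {real i * h..(real i + 1) * h}"
      by (subst has_integral_cong[OF arg_cong[OF cell[OF i]]], assumption,
          rule has_integral_eq_rhs[OF has_integral_affine_moments(2)[OF le]])
         (simp add: P1_def field_simps eval_nat_numeral)
  qed (use h in simp)
  moreover have "P1 (real n) - P1 0 = x0^4 * moment1 (1 / real n)"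
    using n by (simp add: P1_def moment1_def x0 field_simps eval_nat_numeral)
  ultimately show "((\<lambda>x. x * f x) has_integral x0^4 * moment1 (1 / real n)) {0..x0}" by (simp add: h)
  have "((\<lambda>x. (f x)\<^sup>2) has_integral P2 (real n) - P2 0) {0..real n * h}"
  proof (rule has_integral_telescope)
    fix i assume i: "i < n"
    show "((\<lambda>x. (f x)\<^sup>2) has_integral P2 (real i + 1) - P2 (real i)) {real i * h..(real i + 1) * h}"
      by (subst has_integral_cong[OF arg_cong[OF cell[OF i]]], assumption,
          rule has_integral_eq_rhs[OF has_integral_affine_moments(3)[OF le]])
         (simp add: P2_def field_simps eval_nat_numeral)
  qed (use h in simp)
  moreover have "P2 (real n) - P2 0 = x0^5 * moment2 (1 / real n)"
    using n by (simp add: P2_def moment2_def x0 field_simps eval_nat_numeral)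
  ultimately show "((\<lambda>x. (f x)\<^sup>2) has_integral x0^5 * moment2 (1 / real n)) {0..x0}" by (simp add: h)
qed

section \<open>Optimal controls and optimal values\<close>

text \<open>
  Up to the factor \<open>y0\<close>, these are the first and second derivative of the cost with respect to the
  control at \<open>g = 0\<close>.
\<close>
definition slope :: "real \<Rightarrow> real \<Rightarrow> real \<Rightarrow> real \<Rightarrow> real \<Rightarrow> real" where
  "slope x0 q b zd t = (b - zd) * (x0^3 * moment0 t) - q * (x0^4 * moment1 t)"

definition curvature :: "real \<Rightarrow> real \<Rightarrow> real \<Rightarrow> real" where
  "curvature x0 M1 t = x0^5 * moment2 t + M1 * x0"

definition opt_control :: "real \<Rightarrow> real \<Rightarrow> real \<Rightarrow> real \<Rightarrow> real \<Rightarrow> real \<Rightarrow> real" where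
  "opt_control x0 q b zd M1 t = - slope x0 q b zd t / curvature x0 M1 t"

definition opt_value :: "real \<Rightarrow> real \<Rightarrow> real \<Rightarrow> real \<Rightarrow> real \<Rightarrow> real \<Rightarrow> real \<Rightarrow> real" where
  "opt_value x0 y0 q b zd M1 t = y0 * (integral {0..x0} (\<lambda>x. (b - zd - q * x)\<^sup>2) / 2
     - (slope x0 q b zd t)\<^sup>2 / (2 * curvature x0 M1 t))"

text \<open>
  The exact problem and all discrete problems are instances, with \<open>f\<close> the respective unit response.
\<close>
lemma optimum_from_moments:
  fixes f :: "real \<Rightarrow> real" and u :: "real \<Rightarrow> real \<times> real \<Rightarrow> real"
  assumes pos: "x0 > 0" "y0 > 0" "M1 > 0" and cont: "continuous_on {0..x0} f"
    and J: "\<And>g. J g = 1/2 * (H_norm x0 y0 (\<lambda>p. u g p - zd))\<^sup>2 + M1/2 * (H_norm x0 y0 (\<lambda>_. g))\<^sup>2"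
    and u: "\<And>g p. u g p = g * f (fst p) + (b - q * fst p)"
    and m: "(f has_integral x0^3 * moment0 t) {0..x0}"
      "((\<lambda>x. x * f x) has_integral x0^4 * moment1 t) {0..x0}"
      "((\<lambda>x. (f x)\<^sup>2) has_integral x0^5 * moment2 t) {0..x0}"
  shows "(ARG_MIN J g. True) = opt_control x0 q b zd M1 t"
    and "J (opt_control x0 q b zd M1 t) = opt_value x0 y0 q b zd M1 t"
proof -
  \<comment> \<open>Positive since it is the integral of a square, without any discussion of the polynomial
    \<open>moment2\<close>.\<close>
  have "x0^5 * moment2 t \<ge> 0" by (rule has_integral_nonneg[OF m(3)]) simp
  hence c: "curvature x0 M1 t > 0" using pos by (simp add: curvature_def add_nonneg_pos)
  have "J g = y0 * (curvature x0 M1 t / 2 * g\<^sup>2 + slope x0 q b zd t * g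
      + integral {0..x0} (\<lambda>x. (b - zd - q * x)\<^sup>2) / 2)" for g
    unfolding J curvature_def slope_def by (rule cost_eq_quadratic[OF pos(1,2) cont u m])
  from arg_min_quadratic[OF pos(2) c this]
  show "(ARG_MIN J g. True) = opt_control x0 q b zd M1 t"
    and "J (opt_control x0 q b zd M1 t) = opt_value x0 y0 q b zd M1 t"
    by (simp_all add: opt_control_def opt_value_def)
qed

lemma exact_optimum:
  assumes "x0 > 0" "y0 > 0" "M1 > 0"
  shows "g_op x0 y0 q b zd M1 = opt_control x0 q b zd M1 0"
    and "J1 x0 y0 q b zd M1 (opt_control x0 q b zd M1 0) = opt_value x0 y0 q b zd M1 0"
proof -
  have cont: "continuous_on {0..x0} (\<lambda>x. state x0 0 0 1 (x, 0))"
    unfolding state_def by (auto intro!: continuous_intros)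
  have aff: "state x0 q b g p = g * state x0 0 0 1 (fst p, 0) + (b - q * fst p)" for g p
    by (simp add: state_def algebra_simps split: prod.split)
  note opt = optimum_from_moments[OF assms cont J1_def aff state_moments[OF assms(1)]]
  show "g_op x0 y0 q b zd M1 = opt_control x0 q b zd M1 0"
    unfolding g_op_def by (rule opt(1))
  show "J1 x0 y0 q b zd M1 (opt_control x0 q b zd M1 0) = opt_value x0 y0 q b zd M1 0"
    by (rule opt(2))
qed

lemma discrete_optimum:
  assumes "x0 > 0" "y0 > 0" "M1 > 0" "n \<ge> 1"
  shows "gh_op x0 y0 q b zd M1 n = opt_control x0 q b zd M1 (1 / real n)"
    and "J1h x0 y0 q b zd M1 n (opt_control x0 q b zd M1 (1 / real n))
      = opt_value x0 y0 q b zd M1 (1 / real n)"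
proof -
  have aff: "discrete_state x0 q b n g p
      = g * discrete_state x0 0 0 n 1 (fst p, 0) + (b - q * fst p)" for g p
    by (simp add: discrete_state_def Let_def algebra_simps split: prod.split)
  note opt = optimum_from_moments[OF assms(1-3) discrete_state_continuous[OF assms(1,4)]
      J1h_def aff discrete_state_moments[OF assms(1,4)]]
  show "gh_op x0 y0 q b zd M1 n = opt_control x0 q b zd M1 (1 / real n)"
    unfolding gh_op_def by (rule opt(1))
  show "J1h x0 y0 q b zd M1 n (opt_control x0 q b zd M1 (1 / real n))
      = opt_value x0 y0 q b zd M1 (1 / real n)"
    by (rule opt(2))
qed

text \<open>
  The factor \<open>- x0^4 * q / 3\<close> is split off the slope and \<open>x0^5\<close> off the curvature. As these cancel
  without dividing by the remaining denominator, the identity holds for every real \<open>t\<close>.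
\<close>
lemma opt_control_closed_form:
  assumes "x0 > 0" "q \<noteq> 0"
  shows "opt_control x0 q b zd M1 t = q / (3 * x0) *
    (((5/8 - (b - zd) / (q * x0)) + t * (3 * (b - zd) / (4 * q * x0) - 1/2)
        + t\<^sup>2 * ((b - zd) / (4 * q * x0) - 1/8))
     / ((2/15 + M1 / x0^4) + t/12 * (t^3/15 + t\<^sup>2/2 + t/3 - 5/2)))"
    (is "_ = _ * (?N / ?D)")
proof -
  have "slope x0 q b zd t = - (x0^4 * q / 3) * ?N"
    using assms by (simp add: slope_def moment0_def moment1_def field_simps eval_nat_numeral)
  moreover have "curvature x0 M1 t = x0^5 * ?D"
    using assms by (simp add: curvature_def moment2_def field_simps eval_nat_numeral)
  ultimately have "opt_control x0 q b zd M1 t = (x0^4 * q / 3) * ?N / (x0^5 * ?D)"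
    by (simp only: opt_control_def minus_mult_left minus_minus)
  also have "\<dots> = (x0^4 * q / 3) / x0^5 * (?N / ?D)" by simp
  also have "(x0^4 * q / 3) / x0^5 = q / (3 * x0)"
    using assms by (simp add: field_simps eval_nat_numeral)
  finally show ?thesis .
qed

section \<open>First-order expansion in the step size\<close>

text \<open>
  The absolute value is harmless even if the derivative \<open>d\<close> of \<open>D\<close> vanishes: the difference quotients
  tend to \<open>d\<close>, hence their absolute values to \<open>\<bar>d\<bar>\<close>, and \<open>\<bar>d\<bar> / x0\<close> serves as \<open>C\<close>. The error \<open>e\<close> is
  prescribed for \<open>n \<ge> 1\<close> only, because \<open>1 / real 0 = 0\<close> has no meaning as a step size.
\<close>
lemma differentiable_imp_abs_diff_expansion:
  fixes D :: "real \<Rightarrow> real"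
  assumes "D differentiable at 0" and x0: "x0 > 0"
    and e: "\<And>n. n \<ge> 1 \<Longrightarrow> e n = \<bar>D 0 - D (1 / real n)\<bar>"
  shows "\<exists>C. (\<lambda>n. e n - C * (x0 / real n)) \<in> o(\<lambda>n. x0 / real n)"
proof -
  obtain d where "(D has_real_derivative d) (at 0)"
    using assms(1) by (auto simp: real_differentiable_def)
  hence "((\<lambda>t. (D t - D 0) / t) \<longlongrightarrow> d) (at 0)"
    by (simp add: has_field_derivative_iff)
  moreover have "filterlim (\<lambda>n. 1 / real n) (at 0) sequentially"
    by (rule filterlim_atI[OF lim_1_over_n]) (auto intro: eventually_sequentiallyI[of 1])
  ultimately have "(\<lambda>n. (D (1 / real n) - D 0) / (1 / real n)) \<longlonglongrightarrow> d"
    by (rule filterlim_compose)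
  hence "(\<lambda>n. (\<bar>(D (1 / real n) - D 0) / (1 / real n)\<bar> - \<bar>d\<bar>) / x0) \<longlonglongrightarrow> (\<bar>d\<bar> - \<bar>d\<bar>) / x0"
    using x0 by (intro tendsto_intros) auto
  moreover have "\<forall>\<^sub>F n in sequentially. (\<bar>(D (1 / real n) - D 0) / (1 / real n)\<bar> - \<bar>d\<bar>) / x0
      = (e n - \<bar>d\<bar> / x0 * (x0 / real n)) / (x0 / real n)"
    using eventually_ge_at_top[of 1]
  proof eventually_elim
    case (elim n)
    hence "\<bar>(D (1 / real n) - D 0) / (1 / real n)\<bar> = e n * real n"
      by (simp add: e abs_mult abs_minus_commute)
    thus ?case using x0 elim by (simp add: field_simps)
  qed
  ultimately have "(\<lambda>n. (e n - \<bar>d\<bar> / x0 * (x0 / real n)) / (x0 / real n)) \<longlonglongrightarrow> (\<bar>d\<bar> - \<bar>d\<bar>) / x0"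
    by (rule Lim_transform_eventually)
  hence "(\<lambda>n. (e n - \<bar>d\<bar> / x0 * (x0 / real n)) / (x0 / real n)) \<longlonglongrightarrow> 0"
    by (simp only: diff_self div_0)
  hence "(\<lambda>n. e n - \<bar>d\<bar> / x0 * (x0 / real n)) \<in> o(\<lambda>n. x0 / real n)"
    by (rule smalloI_tendsto) (use x0 in \<open>auto intro: eventually_sequentiallyI[of 1]\<close>)
  thus ?thesis by blast
qed

lemma optimum_differentiable:
  assumes "x0 > 0" "M1 > 0"
  shows "opt_control x0 q b zd M1 differentiable at 0"
    and "opt_value x0 y0 q b zd M1 differentiable at 0"
proof -
  have "curvature x0 M1 0 > 0"
    using assms by (simp add: curvature_def moment2_def add_pos_pos)
  hence "curvature x0 M1 0 \<noteq> 0" by simp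
  moreover have "slope x0 q b zd differentiable at 0"
    unfolding slope_def[abs_def] moment0_def moment1_def by (intro derivative_intros) simp_all
  moreover have "curvature x0 M1 differentiable at 0"
    unfolding curvature_def[abs_def] moment2_def by (intro derivative_intros) simp_all
  ultimately show "opt_control x0 q b zd M1 differentiable at 0"
    and "opt_value x0 y0 q b zd M1 differentiable at 0"
    unfolding opt_control_def[abs_def] opt_value_def[abs_def]
    by (intro derivative_intros; simp)+
qed

theorem lemma4:
  fixes x0 y0 q b zd M1 :: real
  assumes "x0 > 0" "y0 > 0" "q \<noteq> 0" "M1 > 0"
  shows "(\<forall>n::nat. n \<ge> 1 \<longrightarrow>
      (let h = x0 / real n;
           A1 = 5/8 - (b - zd) / (q * x0);
           A2 = 3 * (b - zd) / (4 * q * x0) - 1/2;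
           A3 = (b - zd) / (4 * q * x0) - 1/8;
           A4 = 2/15 + M1 / x0 ^ 4;
           A5 = h / (12 * x0) * (h ^ 3 / (15 * x0 ^ 3) + h ^ 2 / (2 * x0 ^ 2) + h / (3 * x0) - 5/2)
       in gh_op x0 y0 q b zd M1 n
          = q / (3 * x0) * ((A1 + h / x0 * A2 + h ^ 2 / x0 ^ 2 * A3) / (A4 + A5))))
    \<and> (\<exists>C3 C4 :: real.
        (\<lambda>n::nat. \<bar>g_op x0 y0 q b zd M1 - gh_op x0 y0 q b zd M1 n\<bar> - C3 * (x0 / real n))
          \<in> o(\<lambda>n. x0 / real n)
      \<and> (\<lambda>n::nat. \<bar>J1 x0 y0 q b zd M1 (g_op x0 y0 q b zd M1)
            - J1h x0 y0 q b zd M1 n (gh_op x0 y0 q b zd M1 n)\<bar> - C4 * (x0 / real n))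
          \<in> o(\<lambda>n. x0 / real n))"
proof (intro conjI allI impI)
  fix n :: nat assume n: "n \<ge> 1"
  define t where "t = 1 / real n"
  have h: "x0 / real n = x0 * t" by (simp add: t_def)
  have "x0 * t / x0 = t" "(x0 * t)\<^sup>2 / x0\<^sup>2 = t\<^sup>2" "x0 * t / (12 * x0) = t/12"
    "(x0 * t)^3 / (15 * x0^3) = t^3/15" "(x0 * t)\<^sup>2 / (2 * x0\<^sup>2) = t\<^sup>2/2" "x0 * t / (3 * x0) = t/3"
    using assms by (simp_all add: power_mult_distrib)
  thus "let h = x0 / real n;
           A1 = 5/8 - (b - zd) / (q * x0);
           A2 = 3 * (b - zd) / (4 * q * x0) - 1/2;
           A3 = (b - zd) / (4 * q * x0) - 1/8;
           A4 = 2/15 + M1 / x0 ^ 4;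
           A5 = h / (12 * x0) * (h ^ 3 / (15 * x0 ^ 3) + h ^ 2 / (2 * x0 ^ 2) + h / (3 * x0) - 5/2)
       in gh_op x0 y0 q b zd M1 n
          = q / (3 * x0) * ((A1 + h / x0 * A2 + h ^ 2 / x0 ^ 2 * A3) / (A4 + A5))"
    unfolding Let_def discrete_optimum(1)[OF assms(1,2,4) n] h t_def[symmetric]
    by (simp only: opt_control_closed_form[OF assms(1,3)])
next
  have "\<exists>C3. (\<lambda>n::nat. \<bar>g_op x0 y0 q b zd M1 - gh_op x0 y0 q b zd M1 n\<bar> - C3 * (x0 / real n))
      \<in> o(\<lambda>n. x0 / real n)"
    by (rule differentiable_imp_abs_diff_expansion[OF optimum_differentiable(1)])
       (use assms in \<open>simp_all add: exact_optimum discrete_optimum\<close>)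
  moreover have "\<exists>C4. (\<lambda>n::nat. \<bar>J1 x0 y0 q b zd M1 (g_op x0 y0 q b zd M1)
        - J1h x0 y0 q b zd M1 n (gh_op x0 y0 q b zd M1 n)\<bar> - C4 * (x0 / real n)) \<in> o(\<lambda>n. x0 / real n)"
    by (rule differentiable_imp_abs_diff_expansion[OF optimum_differentiable(2)])
       (use assms in \<open>simp_all add: exact_optimum discrete_optimum\<close>)
  ultimately show "\<exists>C3 C4 :: real.
        (\<lambda>n::nat. \<bar>g_op x0 y0 q b zd M1 - gh_op x0 y0 q b zd M1 n\<bar> - C3 * (x0 / real n))
          \<in> o(\<lambda>n. x0 / real n)
      \<and> (\<lambda>n::nat. \<bar>J1 x0 y0 q b zd M1 (g_op x0 y0 q b zd M1)
            - J1h x0 y0 q b zd M1 n (gh_op x0 y0 q b zd M1 n)\<bar> - C4 * (x0 / real n))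
          \<in> o(\<lambda>n. x0 / real n)"
    by blast
qed

end
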